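(* Let $X$ be a metric space, let $n\ge 0$ be an integer, and let $\{F_\alpha\}$ be a family of subsets of $X$ with $X=\bigcup_\alpha F_\alpha$ such that $\operatorname{asdim}F_\alpha\le n$ uniformly. Suppose that for every $r>0$ there exists a subset $Y_r\subset X$ with $\operatorname{asdim}Y_r\le n$ such that the family $\{F_\alpha\setminus Y_r\}_\alpha$ is $r$-disjoint. Then $\operatorname{asdim}X\le n$.
   Context: Subsets of a metric space carry the restricted metric. Two sets $U_1,U_2$ in a metric space are $d$-disjoint if $\inf\{\operatorname{dist}(x_1,x_2)\mid x_1\in U_1,\ x_2\in U_2\}\ge d$; a family of sets is $d$-disjoint if any two distinct members (members with different indices, for an indexed family) are $d$-disjoint. A family of sets is $R$-bounded if every member has diameter at most $R$, and uniformly bounded if it is $R$-bounded for some $R$. A metric space $X$ satisfies $\operatorname{asdim}X\le n$ if for every (arbitrarily large) $d>0$ there are $n+1$ uniformly bounded $d$-disjoint families $\mathcal U^0,\dots,\mathcal U^n$ of subsets of $X$ such that $\bigcup_i\mathcal U^i$ covers $X$. A family of metric spaces $\{F_\alpha\}$ satisfies $\operatorname{asdim}F_\alpha\le n$ uniformly if for every (arbitrarily large) $d>0$ there is $R$ (independent of $\alpha$) such that for every $\alpha$ there are $R$-bounded $d$-disjoint families $\mathcal U^0_\alpha,\dots,\mathcal U^n_\alpha$ of subsets of $F_\alpha$ whose union $\bigcup_i\mathcal U^i_\alpha$ covers $F_\alpha$. *)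

theory Defs
  imports "HOL-Analysis.Analysis"
begin

text \<open>Metric spaces are subsets of a type of class \<open>metric_space\<close>, with the restricted metric.
  The infimum in the next definition is taken in the extended reals, so that it is \<open>\<infinity>\<close> when
  one of the two sets is empty.\<close>

definition d_disjoint :: "real \<Rightarrow> 'a::metric_space set \<Rightarrow> 'a set \<Rightarrow> bool" where
  "d_disjoint d U1 U2 \<longleftrightarrow> ereal d \<le> (INF (x1, x2) \<in> U1 \<times> U2. ereal (dist x1 x2))"

text \<open>Indexed families are compared at distinct indices: two members with different indices must
  be \<open>d\<close>-disjoint even if they are equal as sets. A set of sets is indexed by itself.\<close>

definition d_disjoint_family :: "real \<Rightarrow> 'i set \<Rightarrow> ('i \<Rightarrow> 'a::metric_space set) \<Rightarrow> bool" where
  "d_disjoint_family d I U \<longleftrightarrow> pairwise (\<lambda>i j. d_disjoint d (U i) (U j)) I"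

abbreviation d_disjoint_sets :: "real \<Rightarrow> 'a::metric_space set set \<Rightarrow> bool" where
  "d_disjoint_sets d \<U> \<equiv> d_disjoint_family d \<U> (\<lambda>U. U)"

text \<open>The conjunct \<open>bounded U\<close> is needed because \<open>diameter\<close> is real-valued and carries no
  information on unbounded sets.\<close>

definition R_bounded :: "real \<Rightarrow> 'a::metric_space set set \<Rightarrow> bool" where
  "R_bounded R \<U> \<longleftrightarrow> (\<forall>U\<in>\<U>. bounded U \<and> diameter U \<le> R)"

definition uniformly_bounded :: "'a::metric_space set set \<Rightarrow> bool" where
  "uniformly_bounded \<U> \<longleftrightarrow> (\<exists>R. R_bounded R \<U>)"

definition asdim_le :: "'a::metric_space set \<Rightarrow> nat \<Rightarrow> bool" where
  "asdim_le X n \<longleftrightarrow> (\<forall>d>0. \<exists>\<U> :: nat \<Rightarrow> 'a set set.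
     (\<forall>i\<le>n. \<U> i \<subseteq> Pow X \<and> uniformly_bounded (\<U> i) \<and> d_disjoint_sets d (\<U> i)) \<and>
     X \<subseteq> (\<Union>i\<le>n. \<Union>(\<U> i)))"

definition asdim_le_uniformly :: "'i set \<Rightarrow> ('i \<Rightarrow> 'a::metric_space set) \<Rightarrow> nat \<Rightarrow> bool" where
  "asdim_le_uniformly I F n \<longleftrightarrow> (\<forall>d>0. \<exists>R. \<forall>\<alpha>\<in>I. \<exists>\<U> :: nat \<Rightarrow> 'a set set.
     (\<forall>i\<le>n. \<U> i \<subseteq> Pow (F \<alpha>) \<and> R_bounded R (\<U> i) \<and> d_disjoint_sets d (\<U> i)) \<and>
     F \<alpha> \<subseteq> (\<Union>i\<le>n. \<Union>(\<U> i)))"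

end

theory Submission imports Defs begin

text \<open>The idea is to merge colour by colour, for a given scale \<open>d\<close>, a cover of \<open>Y\<close> with a cover
  of its complement.

  Remove from \<open>X\<close> the set \<open>Y\<close> that belongs to the same scale \<open>d\<close>. The uniform covers of the
  \<open>F \<alpha>\<close>, restricted to \<open>F \<alpha> - Y\<close>, can be pooled over all \<open>\<alpha>\<close>: two pieces from the same
  \<open>F \<alpha>\<close> are \<open>d\<close>-disjoint by the choice of the cover, and two pieces from different ones because
  the sets \<open>F \<alpha> - Y\<close> are (lemma \<open>d_disjoint_sets_restricted_union\<close>). Hence \<open>X - Y\<close> has a
  \<open>d\<close>-disjoint cover in \<open>n + 1\<close> colours with pieces of some bounded size \<open>R\<close>.

  Only now, with \<open>R\<close> known, is \<open>Y\<close> itself covered, at the much larger scale \<open>3 * d + 2 * R\<close>.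
  A small piece \<open>U\<close> may be close to a large piece \<open>V\<close> of its colour. It is then absorbed
  into \<open>V\<close>. Absorption enlarges \<open>V\<close> only within its \<open>(d + R)\<close>-neighbourhood, so the enlarged
  pieces are still bounded and still \<open>d\<close>-disjoint; a small piece that is not absorbed is
  \<open>d\<close>-disjoint from every large one and from every other small one (lemmas
  \<open>d_disjoint_sets_saturated_union\<close> and \<open>R_bounded_saturated_union\<close>).\<close>

section \<open>Disjointness and boundedness in terms of points\<close>

lemma d_disjoint_iff: "d_disjoint d A B \<longleftrightarrow> (\<forall>x\<in>A. \<forall>y\<in>B. d \<le> dist x y)"
  unfolding d_disjoint_def by (auto simp: le_INF_iff)

lemma d_disjoint_sym: "d_disjoint d A B \<Longrightarrow> d_disjoint d B A"
  unfolding d_disjoint_iff by (metis dist_commute)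

lemma d_disjoint_mono: "d_disjoint d A B \<Longrightarrow> A' \<subseteq> A \<Longrightarrow> B' \<subseteq> B \<Longrightarrow> d_disjoint d A' B'"
  by (auto simp: d_disjoint_iff)

lemma d_disjoint_setsD:
  "d_disjoint_sets d \<U> \<Longrightarrow> A \<in> \<U> \<Longrightarrow> B \<in> \<U> \<Longrightarrow> A \<noteq> B \<Longrightarrow> d_disjoint d A B"
  by (auto simp: d_disjoint_family_def pairwise_def)

lemma R_boundedD:
  "R_bounded R \<U> \<Longrightarrow> U \<in> \<U> \<Longrightarrow> x \<in> U \<Longrightarrow> y \<in> U \<Longrightarrow> dist x y \<le> R"
  unfolding R_bounded_def using diameter_bounded_bound order_trans by blast

text \<open>The sign condition is for the empty set, whose diameter is \<open>0\<close>.\<close>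

lemma R_boundedI:
  assumes "R \<ge> 0" and dist_le: "\<And>U x y. U \<in> \<U> \<Longrightarrow> x \<in> U \<Longrightarrow> y \<in> U \<Longrightarrow> dist x y \<le> R"
  shows "R_bounded R \<U>"
  unfolding R_bounded_def
proof (intro ballI conjI)
  fix U assume U: "U \<in> \<U>"
  show "bounded U"
    unfolding bounded_two_points using dist_le[OF U] by blast
  show "diameter U \<le> R"
    unfolding diameter_def using dist_le[OF U] \<open>R \<ge> 0\<close> by (auto intro!: cSUP_least)
qed

section \<open>Pooling covers of disjoint sets\<close>

lemma d_disjoint_sets_restricted_union:
  assumes disj: "d_disjoint_family d I G"
    and fam: "\<And>\<alpha>. \<alpha> \<in> I \<Longrightarrow> d_disjoint_sets d (\<U> \<alpha>)"
  shows "d_disjoint_sets d (\<Union>\<alpha>\<in>I. (\<lambda>U. U \<inter> G \<alpha>) ` \<U> \<alpha>)"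
  unfolding d_disjoint_family_def pairwise_def
proof (intro ballI impI)
  fix A B
  assume "A \<in> (\<Union>\<alpha>\<in>I. (\<lambda>U. U \<inter> G \<alpha>) ` \<U> \<alpha>)" "B \<in> (\<Union>\<alpha>\<in>I. (\<lambda>U. U \<inter> G \<alpha>) ` \<U> \<alpha>)"
    and "A \<noteq> B"
  then obtain \<alpha> \<beta> U W where \<alpha>: "\<alpha> \<in> I" "U \<in> \<U> \<alpha>" "A = U \<inter> G \<alpha>"
    and \<beta>: "\<beta> \<in> I" "W \<in> \<U> \<beta>" "B = W \<inter> G \<beta>" by blast
  show "d_disjoint d A B"
  proof (cases "\<alpha> = \<beta>")
    case True
    then have "U \<noteq> W" using \<alpha> \<beta> \<open>A \<noteq> B\<close> by blast
    then have "d_disjoint d U W" using d_disjoint_setsD fam \<alpha> \<beta> True by blast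
    then show ?thesis by (rule d_disjoint_mono) (use \<alpha> \<beta> in auto)
  next
    case False
    then have "d_disjoint d (G \<alpha>) (G \<beta>)"
      using disj \<alpha> \<beta> by (auto simp: d_disjoint_family_def pairwise_def)
    then show ?thesis by (rule d_disjoint_mono) (use \<alpha> \<beta> in auto)
  qed
qed

section \<open>Absorbing small sets into large ones\<close>

definition saturation :: "real \<Rightarrow> 'a::metric_space set set \<Rightarrow> 'a set \<Rightarrow> 'a set" where
  "saturation d \<U> V = V \<union> \<Union>{U\<in>\<U>. \<not> d_disjoint d U V}"

definition saturated_union ::
    "real \<Rightarrow> 'a::metric_space set set \<Rightarrow> 'a set set \<Rightarrow> 'a set set" where
  "saturated_union d \<U> \<V> = saturation d \<U> ` \<V> \<union> {U\<in>\<U>. \<forall>V\<in>\<V>. d_disjoint d U V}"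

lemma Union_saturated_union: "\<Union>(saturated_union d \<U> \<V>) = \<Union>\<U> \<union> \<Union>\<V>"
  unfolding saturated_union_def saturation_def by blast

text \<open>From a point of an absorbed set one reaches a witness of its closeness to \<open>V\<close> within \<open>R\<close>,
  and from there \<open>V\<close> within \<open>d\<close>.\<close>

lemma saturation_near:
  assumes "R_bounded R \<U>" "R \<ge> 0" "d > 0" "x \<in> saturation d \<U> V"
  obtains v where "v \<in> V" "dist x v \<le> d + R"
proof (cases "x \<in> V")
  case True
  with that[of x] assms show ?thesis by auto
next
  case False
  then obtain U where U: "U \<in> \<U>" "x \<in> U" "\<not> d_disjoint d U V"
    using assms unfolding saturation_def by blast
  then obtain u v where uv: "u \<in> U" "v \<in> V" "dist u v < d"
    by (auto simp: d_disjoint_iff not_le)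
  have "dist x u \<le> R" using R_boundedD assms(1) U uv by blast
  then show ?thesis using that[of v] uv dist_triangle[of x v u] by auto
qed

lemma R_bounded_saturated_union:
  assumes \<U>: "R_bounded R \<U>" and \<V>: "R_bounded S \<V>" and pos: "R \<ge> 0" "S \<ge> 0" "d > 0"
  shows "R_bounded (S + 2 * (d + R)) (saturated_union d \<U> \<V>)"
proof (rule R_boundedI)
  show "S + 2 * (d + R) \<ge> 0" using pos by auto
next
  fix W x y assume W: "W \<in> saturated_union d \<U> \<V>" "x \<in> W" "y \<in> W"
  consider V where "V \<in> \<V>" "W = saturation d \<U> V" | "W \<in> \<U>"
    using W unfolding saturated_union_def by blast
  then show "dist x y \<le> S + 2 * (d + R)"
  proof cases
    case 1
    obtain v where v: "v \<in> V" "dist x v \<le> d + R"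
      using saturation_near[OF \<U>] pos W 1 by blast
    obtain w where w: "w \<in> V" "dist y w \<le> d + R"
      using saturation_near[OF \<U>] pos W 1 by blast
    have "dist v w \<le> S" using R_boundedD[OF \<V>] 1 v w by blast
    then show ?thesis
      using v w dist_triangle[of x y v] dist_triangle[of v y w] by (simp add: dist_commute)
  next
    case 2
    then have "dist x y \<le> R" using R_boundedD[OF \<U>] W by blast
    then show ?thesis using pos by auto
  qed
qed

text \<open>The scale \<open>3 * d + 2 * R\<close> leaves a gap of \<open>d\<close> after two members of \<open>\<V>\<close> have each grown by
  at most \<open>d + R\<close>.\<close>

lemma d_disjoint_sets_saturated_union:
  assumes bdd: "R_bounded R \<U>" and \<U>: "d_disjoint_sets d \<U>"
    and \<V>: "d_disjoint_sets (3 * d + 2 * R) \<V>" and pos: "R \<ge> 0" "d > 0"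
  shows "d_disjoint_sets d (saturated_union d \<U> \<V>)"
proof -
  have large_large: "d_disjoint d (saturation d \<U> V) (saturation d \<U> V')"
    if V: "V \<in> \<V>" "V' \<in> \<V>" "V \<noteq> V'" for V V'
    unfolding d_disjoint_iff
  proof (intro ballI)
    fix x y assume "x \<in> saturation d \<U> V" "y \<in> saturation d \<U> V'"
    then obtain v w where vw: "v \<in> V" "dist x v \<le> d + R" "w \<in> V'" "dist y w \<le> d + R"
      using saturation_near[OF bdd pos] by metis
    have "3 * d + 2 * R \<le> dist v w"
      using d_disjoint_setsD[OF \<V>] V vw by (auto simp: d_disjoint_iff)
    then show "d \<le> dist x y"
      using vw dist_triangle[of v w x] dist_triangle[of x w y] by (simp add: dist_commute)
  qed
  have small_large: "d_disjoint d U (saturation d \<U> V)"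
    if U: "U \<in> \<U>" "\<forall>V\<in>\<V>. d_disjoint d U V" and V: "V \<in> \<V>" for U V
  proof -
    \<comment> \<open>An absorbed set differs from \<open>U\<close>, which is not close to \<open>V\<close>.\<close>
    have "d_disjoint d U U'" if "U' \<in> \<U>" "\<not> d_disjoint d U' V" for U'
      using that U V d_disjoint_setsD[OF \<U>, of U U'] by blast
    moreover have "d_disjoint d U V" using U V by blast
    ultimately show ?thesis by (fastforce simp: saturation_def d_disjoint_iff)
  qed
  show ?thesis
    unfolding d_disjoint_family_def pairwise_def
  proof (intro ballI impI)
    fix A B assume A: "A \<in> saturated_union d \<U> \<V>" and B: "B \<in> saturated_union d \<U> \<V>"
      and ne: "A \<noteq> B"
    consider V V' where "V \<in> \<V>" "V' \<in> \<V>" "A = saturation d \<U> V" "B = saturation d \<U> V'"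
      | V where "V \<in> \<V>" "A = saturation d \<U> V" "B \<in> \<U>" "\<forall>V\<in>\<V>. d_disjoint d B V"
      | V where "V \<in> \<V>" "B = saturation d \<U> V" "A \<in> \<U>" "\<forall>V\<in>\<V>. d_disjoint d A V"
      | "A \<in> \<U>" "B \<in> \<U>"
      using A B unfolding saturated_union_def by blast
    then show "d_disjoint d A B"
    proof cases
      case 1
      then show ?thesis using large_large ne by metis
    next
      case 2
      then show ?thesis using small_large[THEN d_disjoint_sym] by simp
    next
      case 3
      then show ?thesis using small_large by simp
    next
      case 4
      then show ?thesis using d_disjoint_setsD[OF \<U>] ne by simp
    qed
  qed
qed

section \<open>The infinite union theorem for asymptotic dimension\<close>

theorem theorem1:
  fixes X :: "'a::metric_space set" and n :: nat
    and I :: "'i set" and F :: "'i \<Rightarrow> 'a set"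
  assumes "\<And>\<alpha>. \<alpha> \<in> I \<Longrightarrow> F \<alpha> \<subseteq> X"
    and "X = (\<Union>\<alpha>\<in>I. F \<alpha>)"
    and "asdim_le_uniformly I F n"
    and "\<And>r::real. r > 0 \<Longrightarrow>
           \<exists>Y. Y \<subseteq> X \<and> asdim_le Y n \<and> d_disjoint_family r I (\<lambda>\<alpha>. F \<alpha> - Y)"
  shows "asdim_le X n"
  unfolding asdim_le_def
proof (intro allI impI)
  fix d :: real assume d: "d > 0"
  obtain Y where Y: "Y \<subseteq> X" "asdim_le Y n" "d_disjoint_family d I (\<lambda>\<alpha>. F \<alpha> - Y)"
    using assms(4)[OF d] by blast
  from assms(3)[unfolded asdim_le_uniformly_def, THEN spec, THEN mp, OF d]
  obtain R0 where "\<forall>\<alpha>\<in>I. \<exists>\<U> :: nat \<Rightarrow> 'a set set.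
     (\<forall>i\<le>n. \<U> i \<subseteq> Pow (F \<alpha>) \<and> R_bounded R0 (\<U> i) \<and> d_disjoint_sets d (\<U> i)) \<and>
     F \<alpha> \<subseteq> (\<Union>i\<le>n. \<Union>(\<U> i))"
    by (elim exE)
  from bchoice[OF this] obtain \<U> :: "'i \<Rightarrow> nat \<Rightarrow> 'a set set" where
    "\<forall>\<alpha>\<in>I. (\<forall>i\<le>n. \<U> \<alpha> i \<subseteq> Pow (F \<alpha>) \<and> R_bounded R0 (\<U> \<alpha> i) \<and> d_disjoint_sets d (\<U> \<alpha> i)) \<and>
     F \<alpha> \<subseteq> (\<Union>i\<le>n. \<Union>(\<U> \<alpha> i))"
    by (elim exE)
  then have \<U>: "\<And>\<alpha> i. \<alpha> \<in> I \<Longrightarrow> i \<le> n \<Longrightarrow> R_bounded R0 (\<U> \<alpha> i) \<and> d_disjoint_sets d (\<U> \<alpha> i)"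
    and \<U>_cover: "\<And>\<alpha>. \<alpha> \<in> I \<Longrightarrow> F \<alpha> \<subseteq> (\<Union>i\<le>n. \<Union>(\<U> \<alpha> i))"
    by simp_all
  \<comment> \<open>The bound of an empty family may be negative.\<close>
  define R where "R = max R0 0"
  have R: "R \<ge> 0" "R0 \<le> R" by (auto simp: R_def)
  define \<W> where "\<W> i = (\<Union>\<alpha>\<in>I. (\<lambda>U. U \<inter> (F \<alpha> - Y)) ` \<U> \<alpha> i)" for i
  have \<W>_bdd: "R_bounded R (\<W> i)" if "i \<le> n" for i
  proof (rule R_boundedI[OF R(1)])
    fix A x y assume "A \<in> \<W> i" "x \<in> A" "y \<in> A"
    then obtain \<alpha> U where "\<alpha> \<in> I" "U \<in> \<U> \<alpha> i" "x \<in> U" "y \<in> U"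
      unfolding \<W>_def by blast
    then have "dist x y \<le> R0" using R_boundedD \<U> that by blast
    then show "dist x y \<le> R" using R by linarith
  qed
  have \<W>_disj: "d_disjoint_sets d (\<W> i)" if "i \<le> n" for i
    unfolding \<W>_def
    by (rule d_disjoint_sets_restricted_union[OF Y(3)]) (use \<U> that in blast)
  have "3 * d + 2 * R > 0" using d R by linarith
  from Y(2)[unfolded asdim_le_def, THEN spec, THEN mp, OF this]
  obtain \<V> :: "nat \<Rightarrow> 'a set set" where
    \<V>: "\<forall>i\<le>n. \<V> i \<subseteq> Pow Y \<and> uniformly_bounded (\<V> i) \<and> d_disjoint_sets (3 * d + 2 * R) (\<V> i)"
    and \<V>_cover: "Y \<subseteq> (\<Union>i\<le>n. \<Union>(\<V> i))"
    by (elim exE conjE)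
  show "\<exists>\<U> :: nat \<Rightarrow> 'a set set.
     (\<forall>i\<le>n. \<U> i \<subseteq> Pow X \<and> uniformly_bounded (\<U> i) \<and> d_disjoint_sets d (\<U> i)) \<and>
     X \<subseteq> (\<Union>i\<le>n. \<Union>(\<U> i))"
  proof (intro exI[of _ "\<lambda>i. saturated_union d (\<W> i) (\<V> i)"] conjI allI impI)
    fix i assume i: "i \<le> n"
    have "\<Union>(\<W> i) \<subseteq> X" using assms(2) unfolding \<W>_def by blast
    moreover have "\<Union>(\<V> i) \<subseteq> X" using \<V>[rule_format, OF i] Y(1) by blast
    ultimately show "saturated_union d (\<W> i) (\<V> i) \<subseteq> Pow X"
      using Union_saturated_union[of d "\<W> i" "\<V> i"] by blast
    obtain S where "R_bounded S (\<V> i)"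
      using \<V>[rule_format, OF i] unfolding uniformly_bounded_def by blast
    then have "R_bounded (max S 0) (\<V> i)" by (fastforce simp: R_bounded_def)
    then show "uniformly_bounded (saturated_union d (\<W> i) (\<V> i))"
      using R_bounded_saturated_union[OF \<W>_bdd[OF i] _ R(1) _ d]
      unfolding uniformly_bounded_def by (meson max.cobounded2)
    show "d_disjoint_sets d (saturated_union d (\<W> i) (\<V> i))"
      using d_disjoint_sets_saturated_union[OF \<W>_bdd[OF i] \<W>_disj[OF i] _ R(1) d] \<V>[rule_format, OF i]
      by blast
  next
    have "x \<in> (\<Union>i\<le>n. \<Union>(\<W> i) \<union> \<Union>(\<V> i))" if x: "x \<in> X" for x
    proof (cases "x \<in> Y")
      case True
      then show ?thesis using \<V>_cover by blast
    next
      case False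
      from x assms(2) obtain \<alpha> where \<alpha>: "\<alpha> \<in> I" "x \<in> F \<alpha>" by blast
      then obtain i U where "i \<le> n" "U \<in> \<U> \<alpha> i" "x \<in> U" using \<U>_cover by blast
      then show ?thesis using \<alpha> False unfolding \<W>_def by blast
    qed
    then show "X \<subseteq> (\<Union>i\<le>n. \<Union>(saturated_union d (\<W> i) (\<V> i)))"
      unfolding Union_saturated_union by blast
  qed
qed

end
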